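(* Let $\varepsilon_n$ be a sequence of positive numbers such that $\varepsilon_n \to 0$ and $n\varepsilon_n^2 \to \infty$. Suppose that, for this $\varepsilon_n$, the following three conditions hold. (S1) There exists a deterministic sequence $\theta^\dagger = \theta_n^\dagger \in \Theta_n$ such that $\max\{K(p_{\theta^\star}^n, p_{\theta^\dagger}^n),\, V(p_{\theta^\star}^n, p_{\theta^\dagger}^n)\} \le n\varepsilon_n^2$ for all large $n$. (LP1) There exist constants $d>0$ and $C > 0$ such that, with $\mathcal{L}_n = \{\theta \in \Theta_n : L_n(\theta) \ge e^{-d n \varepsilon_n^2} L_n(\hat\theta_n)\}$, $$\mathsf{P}_{\theta^\star}^n\{\Pi_n(\mathcal{L}_n) < e^{-C n \varepsilon_n^2}\} \to 0, \quad n \to \infty.$$ (GP1) There exist constants $K>0$ and $p>1$ such that the density $\pi_n$ of the empirical prior $\Pi_n$ satisfies $$\int_{\Theta_n} \bigl[\mathsf{E}_{\theta^\star}^n\{\pi_n(\theta)^p\}\bigr]^{1/p}\,\nu_n(d\theta) \le e^{K n \varepsilon_n^2}.$$ Then there exists a constant $M>0$ such that $\mathsf{E}_{\theta^\star}^n\{\Pi^n(A_{M\varepsilon_n})\} \to 0$ as $n\to\infty$. If, instead of $n\varepsilon_n^2\to\infty$, one has $\varepsilon_n = O(n^{-1/2})$ (with $\varepsilon_n$ tending to $0$ no faster than $n^{-1/2}$), and (S1), (LP1), (GP1) hold for this $\varepsilon_n$, then the same conclusion holds with the constant $M$ replaced by an arbitrary sequence $M_n \to \infty$, i.e., $\mathsf{E}_{\theta^\star}^n\{\Pi^n(A_{M_n\varepsilon_n})\}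 \to 0$.
   Context: For each $n\ge 1$, $X^n$ denotes data (not necessarily iid or independent) with joint distribution $\mathsf{P}_\theta^n$ having density $p_\theta^n$ with respect to a dominating measure $\mu$, indexed by a parameter $\theta\in\Theta$ (possibly infinite-dimensional). $\theta^\star\in\Theta$ is the true parameter value, and $\mathsf{E}_{\theta^\star}^n$ is expectation under $X^n\sim\mathsf{P}_{\theta^\star}^n$. The likelihood is $L_n(\theta)=p_\theta^n(X^n)$. For densities $f,g$ with respect to $\mu$: $K(f,g)=\int \log(f/g)\,f\,d\mu$, $V(f,g)=\int \log^2(f/g)\,f\,d\mu$, and the Hellinger distance is $H^2(f,g)=\frac12\int (f^{1/2}-g^{1/2})^2\,d\mu$. A sieve $\Theta_n$ is an increasing sequence of finite-dimensional subsets of $\Theta$; $\hat\theta_n=\arg\max_{\theta\in\Theta_n}L_n(\theta)$ is a sieve maximum likelihood estimator. $\Theta_n$ is equipped with a data-independent measure $\nu_n$ (e.g., Lebesgue measure). An empirical prior $\Pi_n$ is a probability measure supported on $\Theta_n$, allowed to depend on the data $X^n$, with density $\pi_n$ (depending on $X^n$) with respect to $\nu_n$. The corresponding posterior is $$\Pi^n(A)=\frac{\int_A L_n(\theta)\,\pi_n(\theta)\,\nu_n(d\theta)}{\int_{\Theta_n}L_n(\theta)\,\pi_n(\theta)\,\nu_n(d\theta)},\quad A\subseteq\Theta_n.$$ For $M>0$, $A_{M\varepsilon_n}=\{\theta: H^2(p_{\theta^\star}^n,p_\theta^n)>1-e^{-M^2 n\varepsilon_n^2}\}$ (intersected with $\Theta_n$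 when its posterior probability is taken). *)

theory Defs
  imports "HOL-Probability.Probability" "HOL-Library.Landau_Symbols"
begin

section \<open>Discrepancies between densities\<close>

text \<open>
  With the conventions of HOL, \<open>ln (a / 0) = ln 0 = 0\<close>, whereas the logarithm of a density ratio
  is infinite at a point that carries mass under the first density only. The case \<open>a = 0\<close> is
  irrelevant, since it is always weighted by \<open>a\<close> below.
\<close>

definition log_ratio :: "real \<Rightarrow> real \<Rightarrow> ereal" where
  "log_ratio a b = (if b = 0 then \<infinity> else ereal (ln (a / b)))"

text \<open>
  The divergence \<open>K\<close> is the difference of the integrals of the positive and of the negative part.
  For probability densities the latter is finite, so \<open>\<infinity> - \<infinity>\<close> does not occur.
\<close>

definition kl_div :: "'x measure \<Rightarrow> ('x \<Rightarrow> real) \<Rightarrow> ('x \<Rightarrow> real) \<Rightarrow> ereal" where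
  "kl_div \<mu> f g =
     enn2ereal (\<integral>\<^sup>+x. e2ennreal (log_ratio (f x) (g x) * ereal (f x)) \<partial>\<mu>)
   - enn2ereal (\<integral>\<^sup>+x. e2ennreal (- (log_ratio (f x) (g x) * ereal (f x))) \<partial>\<mu>)"

definition kl_var :: "'x measure \<Rightarrow> ('x \<Rightarrow> real) \<Rightarrow> ('x \<Rightarrow> real) \<Rightarrow> ereal" where
  "kl_var \<mu> f g = enn2ereal (\<integral>\<^sup>+x. e2ennreal ((log_ratio (f x) (g x))\<^sup>2 * ereal (f x)) \<partial>\<mu>)"

definition hellinger_sq :: "'x measure \<Rightarrow> ('x \<Rightarrow> real) \<Rightarrow> ('x \<Rightarrow> real) \<Rightarrow> real" where
  "hellinger_sq \<mu> f g = (1 / 2) * (\<integral>x. (sqrt (f x) - sqrt (g x))\<^sup>2 \<partial>\<mu>)"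


section \<open>The model, the sieve and the empirical prior\<close>

definition data_dist :: "'x measure \<Rightarrow> ('x \<Rightarrow> real) \<Rightarrow> 'x measure" where
  "data_dist \<mu> f = density \<mu> (\<lambda>x. ennreal (f x))"

definition prior_dist :: "'t measure \<Rightarrow> ('t \<Rightarrow> real) \<Rightarrow> 't measure" where
  "prior_dist \<nu> q = density \<nu> (\<lambda>\<theta>. ennreal (q \<theta>))"

text \<open>
  Since the parameter set carries neither a linear structure nor a topology, a sieve set is called
  finite-dimensional if finitely many measurable real coordinates identify its points. Subsets of
  finite-dimensional vector spaces, finite-dimensional manifolds and finite unions of such sets,
  with their Borel sets, all have this property.
\<close>

definition finite_dimensional :: "'t measure \<Rightarrow> bool" where
  "finite_dimensional \<nu> \<longleftrightarrow>
     (\<exists>(k::nat) \<phi>. \<phi> \<in> measurable \<nu> (Pi\<^sub>M {..<k} (\<lambda>_. borel :: real measure)) \<and> inj_on \<phi> (space \<nu>))"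

text \<open>
  Sample size \<open>n\<close> ranges over \<open>n \<ge> 1\<close>. The observation lives in \<open>space (\<mu> n)\<close> and has density
  \<open>p n \<theta>\<close> with respect to \<open>\<mu> n\<close>; the likelihood of \<open>\<theta>\<close> at the data \<open>x\<close> is \<open>p n \<theta> x\<close>. The
  empirical prior for the data \<open>x\<close> has density \<open>q n x\<close> with respect to \<open>\<nu> n\<close>, a measure on the
  sieve set \<open>S n\<close>. Measurability and sigma-finiteness are what is needed for the integrals and
  probabilities in the theory to be meaningful.
\<close>

locale empirical_bayes_sieve =
  fixes \<mu> :: "nat \<Rightarrow> 'x measure"
    and p :: "nat \<Rightarrow> 't \<Rightarrow> 'x \<Rightarrow> real"
    and \<Theta> :: "'t set"
    and \<theta>s :: 't
    and S :: "nat \<Rightarrow> 't set"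
    and \<nu> :: "nat \<Rightarrow> 't measure"
    and \<theta>hat :: "nat \<Rightarrow> 'x \<Rightarrow> 't"
    and q :: "nat \<Rightarrow> 'x \<Rightarrow> 't \<Rightarrow> real"
  assumes mu_sigma_finite: "\<And>n. n \<ge> 1 \<Longrightarrow> sigma_finite_measure (\<mu> n)"
    and p_nonneg: "\<And>n \<theta> x. n \<ge> 1 \<Longrightarrow> \<theta> \<in> \<Theta> \<Longrightarrow> x \<in> space (\<mu> n) \<Longrightarrow> 0 \<le> p n \<theta> x"
    and p_measurable: "\<And>n \<theta>. n \<ge> 1 \<Longrightarrow> \<theta> \<in> \<Theta> \<Longrightarrow> p n \<theta> \<in> borel_measurable (\<mu> n)"
    and p_prob: "\<And>n \<theta>. n \<ge> 1 \<Longrightarrow> \<theta> \<in> \<Theta> \<Longrightarrow> prob_space (data_dist (\<mu> n) (p n \<theta>))"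
    and true_parameter: "\<theta>s \<in> \<Theta>"
    and sieve_subset: "\<And>n. n \<ge> 1 \<Longrightarrow> S n \<subseteq> \<Theta>"
    and sieve_increasing: "mono_on {1..} S"
    and sieve_finite_dimensional: "\<And>n. n \<ge> 1 \<Longrightarrow> finite_dimensional (\<nu> n)"
    and nu_space: "\<And>n. n \<ge> 1 \<Longrightarrow> space (\<nu> n) = S n"
    and nu_sigma_finite: "\<And>n. n \<ge> 1 \<Longrightarrow> sigma_finite_measure (\<nu> n)"
    and p_jointly_measurable:
      "\<And>n. n \<ge> 1 \<Longrightarrow> (\<lambda>(x, \<theta>). p n \<theta> x) \<in> borel_measurable (\<mu> n \<Otimes>\<^sub>M \<nu> n)"
    and mle: "\<And>n. n \<ge> 1 \<Longrightarrow>
      AE x in data_dist (\<mu> n) (p n \<theta>s). is_arg_max (\<lambda>\<theta>. p n \<theta> x) (\<lambda>\<theta>. \<theta> \<in> S n) (\<theta>hat n x)"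
    and max_likelihood_measurable:
      "\<And>n. n \<ge> 1 \<Longrightarrow> (\<lambda>x. p n (\<theta>hat n x) x) \<in> borel_measurable (\<mu> n)"
    and prior_nonneg:
      "\<And>n x \<theta>. n \<ge> 1 \<Longrightarrow> x \<in> space (\<mu> n) \<Longrightarrow> \<theta> \<in> S n \<Longrightarrow> 0 \<le> q n x \<theta>"
    and prior_jointly_measurable:
      "\<And>n. n \<ge> 1 \<Longrightarrow> (\<lambda>(x, \<theta>). q n x \<theta>) \<in> borel_measurable (\<mu> n \<Otimes>\<^sub>M \<nu> n)"
    and prior_prob:
      "\<And>n x. n \<ge> 1 \<Longrightarrow> x \<in> space (\<mu> n) \<Longrightarrow> prob_space (prior_dist (\<nu> n) (q n x))"

text \<open>
  In \<open>ennreal\<close>, \<open>0 / 0 = 0\<close> and \<open>\<top> / \<top> = 0\<close>; this fixes the value of the posterior at data for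
  which the normalizing constant is zero or infinite.
\<close>

definition posterior :: "'t measure \<Rightarrow> ('t \<Rightarrow> real) \<Rightarrow> ('t \<Rightarrow> real) \<Rightarrow> 't set \<Rightarrow> ennreal" where
  "posterior \<nu> L q A =
     (\<integral>\<^sup>+\<theta>\<in>A. ennreal (L \<theta> * q \<theta>) \<partial>\<nu>) / (\<integral>\<^sup>+\<theta>. ennreal (L \<theta> * q \<theta>) \<partial>\<nu>)"

text \<open>The set \<open>A\<close> for sample size \<open>n\<close>, radius multiplier \<open>M\<close> and rate \<open>e = \<epsilon> n\<close>.\<close>

definition far_set ::
  "(nat \<Rightarrow> 'x measure) \<Rightarrow> (nat \<Rightarrow> 't \<Rightarrow> 'x \<Rightarrow> real) \<Rightarrow> 't set \<Rightarrow> 't \<Rightarrow> nat \<Rightarrow> real \<Rightarrow> real \<Rightarrow> 't set"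
where
  "far_set \<mu> p \<Theta> \<theta>s n M e =
     {\<theta> \<in> \<Theta>. hellinger_sq (\<mu> n) (p n \<theta>s) (p n \<theta>) > 1 - exp (- (M\<^sup>2 * real n * e\<^sup>2))}"

definition expected_posterior_far ::
  "(nat \<Rightarrow> 'x measure) \<Rightarrow> (nat \<Rightarrow> 't \<Rightarrow> 'x \<Rightarrow> real) \<Rightarrow> 't set \<Rightarrow> 't \<Rightarrow> (nat \<Rightarrow> 't set) \<Rightarrow>
   (nat \<Rightarrow> 't measure) \<Rightarrow> (nat \<Rightarrow> 'x \<Rightarrow> 't \<Rightarrow> real) \<Rightarrow> nat \<Rightarrow> real \<Rightarrow> real \<Rightarrow> ennreal"
where
  "expected_posterior_far \<mu> p \<Theta> \<theta>s S \<nu> q n M e =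
     (\<integral>\<^sup>+x. posterior (\<nu> n) (\<lambda>\<theta>. p n \<theta> x) (q n x) (far_set \<mu> p \<Theta> \<theta>s n M e \<inter> S n)
        \<partial>data_dist (\<mu> n) (p n \<theta>s))"


section \<open>The conditions on the sieve and on the empirical prior\<close>

definition cond_S1 ::
  "(nat \<Rightarrow> 'x measure) \<Rightarrow> (nat \<Rightarrow> 't \<Rightarrow> 'x \<Rightarrow> real) \<Rightarrow> 't \<Rightarrow> (nat \<Rightarrow> 't set) \<Rightarrow> (nat \<Rightarrow> real) \<Rightarrow> bool"
where
  "cond_S1 \<mu> p \<theta>s S \<epsilon> \<longleftrightarrow>
     (\<exists>\<theta>d :: nat \<Rightarrow> 't. (\<forall>n\<ge>1. \<theta>d n \<in> S n) \<and>
        (\<forall>\<^sub>F n in sequentially.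
           max (kl_div (\<mu> n) (p n \<theta>s) (p n (\<theta>d n))) (kl_var (\<mu> n) (p n \<theta>s) (p n (\<theta>d n)))
             \<le> ereal (real n * (\<epsilon> n)\<^sup>2)))"

definition high_likelihood_set ::
  "('t \<Rightarrow> 'x \<Rightarrow> real) \<Rightarrow> 't set \<Rightarrow> ('x \<Rightarrow> 't) \<Rightarrow> real \<Rightarrow> 'x \<Rightarrow> 't set" where
  "high_likelihood_set f T \<theta>hat r x = {\<theta> \<in> T. f \<theta> x \<ge> exp (- r) * f (\<theta>hat x) x}"

definition cond_LP1 ::
  "(nat \<Rightarrow> 'x measure) \<Rightarrow> (nat \<Rightarrow> 't \<Rightarrow> 'x \<Rightarrow> real) \<Rightarrow> 't \<Rightarrow> (nat \<Rightarrow> 't set) \<Rightarrow> (nat \<Rightarrow> 't measure) \<Rightarrow>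
   (nat \<Rightarrow> 'x \<Rightarrow> 't) \<Rightarrow> (nat \<Rightarrow> 'x \<Rightarrow> 't \<Rightarrow> real) \<Rightarrow> (nat \<Rightarrow> real) \<Rightarrow> bool"
where
  "cond_LP1 \<mu> p \<theta>s S \<nu> \<theta>hat q \<epsilon> \<longleftrightarrow>
     (\<exists>d>0. \<exists>C>0.
        (\<lambda>n. measure (data_dist (\<mu> n) (p n \<theta>s))
           {x \<in> space (\<mu> n).
              measure (prior_dist (\<nu> n) (q n x))
                (high_likelihood_set (p n) (S n) (\<theta>hat n) (d * real n * (\<epsilon> n)\<^sup>2) x)
              < exp (- (C * real n * (\<epsilon> n)\<^sup>2))})
        \<longlonglongrightarrow> 0)"

text \<open>Only positive exponents are used, so that \<open>\<top>\<close> is mapped to \<open>\<top>\<close>.\<close>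

definition ennreal_powr :: "ennreal \<Rightarrow> real \<Rightarrow> ennreal" where
  "ennreal_powr a r = (if a = \<top> then \<top> else ennreal (enn2real a powr r))"

definition cond_GP1 ::
  "(nat \<Rightarrow> 'x measure) \<Rightarrow> (nat \<Rightarrow> 't \<Rightarrow> 'x \<Rightarrow> real) \<Rightarrow> 't \<Rightarrow> (nat \<Rightarrow> 't measure) \<Rightarrow>
   (nat \<Rightarrow> 'x \<Rightarrow> 't \<Rightarrow> real) \<Rightarrow> (nat \<Rightarrow> real) \<Rightarrow> bool"
where
  "cond_GP1 \<mu> p \<theta>s \<nu> q \<epsilon> \<longleftrightarrow>
     (\<exists>K>0. \<exists>r>1. \<forall>n\<ge>1.
        (\<integral>\<^sup>+\<theta>. ennreal_powr
                 (\<integral>\<^sup>+x. ennreal (q n x \<theta> powr r) \<partial>data_dist (\<mu> n) (p n \<theta>s)) (1 / r) \<partial>\<nu> n)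
          \<le> ennreal (exp (K * real n * (\<epsilon> n)\<^sup>2)))"

end

theory Submission
  imports Defs
begin

text \<open>
  Put \<open>\<rho> = n \<epsilon>\<^sup>2\<close>, let \<open>s\<close> be the exponent conjugate to the one in (GP1) and \<open>a = 1 / (2 s)\<close>. On the
  event of (LP1) the normalizing constant of the posterior is at least \<open>exp (- (d + C) \<rho>)\<close> times
  the maximal likelihood. In the numerator, likelihood over maximal likelihood is at most its
  \<open>a\<close>-th power, and the maximal likelihood is at least the likelihood of the approximating
  parameter in (S1), which with probability at least \<open>1 - 1 / (m\<^sup>2 \<rho>)\<close> (Chebyshev, with
  second moment \<open>V\<close>) is at least \<open>exp (- m \<rho>)\<close> times the likelihood of the truth. What is left is the prior integral
  of the \<open>a\<close>-th power of the likelihood ratio to the truth. By Fubini and Hoelder its expectation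
  over the far set is at most \<open>exp (K \<rho>)\<close> times the largest value of \<open>(1 - H\<^sup>2)\<close> to the power
  \<open>1 / s\<close>, because the ratio to the power \<open>a s = 1/2\<close> has expectation \<open>1 - H\<^sup>2 < exp (- m\<^sup>2 \<rho>)\<close>.
\<close>

section \<open>Hellinger affinity and Hoelder's inequality\<close>

text \<open>Expanding the square, each density contributes mass 1, so half the integral is 1 minus
  the affinity. The Lebesgue integral on the left is the form in which the root of a likelihood
  ratio appears after Fubini and Hoelder.\<close>

lemma nn_integral_sqrt_mult_hellinger:
  assumes f [measurable]: "f \<in> borel_measurable \<mu>" and g [measurable]: "g \<in> borel_measurable \<mu>"
    and f_nonneg: "\<And>x. x \<in> space \<mu> \<Longrightarrow> 0 \<le> f x" and g_nonneg: "\<And>x. x \<in> space \<mu> \<Longrightarrow> 0 \<le> g x"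
    and f_prob: "prob_space (data_dist \<mu> f)" and g_prob: "prob_space (data_dist \<mu> g)"
  shows "(\<integral>\<^sup>+x. ennreal (sqrt (f x * g x)) \<partial>\<mu>) = ennreal (1 - hellinger_sq \<mu> f g)"
proof -
  have one: "(\<integral>\<^sup>+x. ennreal (h x) \<partial>\<mu>) = 1"
    if "prob_space (data_dist \<mu> h)" "h \<in> borel_measurable \<mu>" for h :: "'a \<Rightarrow> real"
    using prob_space.emeasure_space_1[OF that(1)] that(2)
    by (simp add: data_dist_def emeasure_density cong: nn_integral_cong)
  have int: "integrable \<mu> h \<and> integral\<^sup>L \<mu> h = 1"
    if "prob_space (data_dist \<mu> h)" "h \<in> borel_measurable \<mu>" "\<And>x. x \<in> space \<mu> \<Longrightarrow> 0 \<le> h x"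
    for h :: "'a \<Rightarrow> real"
  proof -
    have ae: "AE x in \<mu>. 0 \<le> h x" using that(3) by (auto intro: AE_I2)
    have "integrable \<mu> h"
      by (rule integrableI_nonneg[OF that(2) ae]) (simp add: one[OF that(1,2)])
    then show ?thesis using nn_integral_eq_integral[OF _ ae] one[OF that(1,2)]
      by (simp add: integral_nonneg_AE[OF ae] ennreal_eq_1)
  qed
  note fi = int[OF f_prob f f_nonneg] and gi = int[OF g_prob g g_nonneg]
  \<comment> \<open>The arithmetic-geometric mean inequality dominates the cross term by the
    integrable \<open>f + g\<close>, so the integral of the expanded square may be split.\<close>
  have si: "integrable \<mu> (\<lambda>x. sqrt (f x * g x))"
  proof (rule Bochner_Integration.integrable_bound)
    show "integrable \<mu> (\<lambda>x. f x + g x)" using fi gi by simp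
    show "AE x in \<mu>. norm (sqrt (f x * g x)) \<le> norm (f x + g x)"
    proof (rule AE_I2)
      fix x assume "x \<in> space \<mu>"
      then have "0 \<le> f x" "0 \<le> g x" using f_nonneg g_nonneg by auto
      then show "norm (sqrt (f x * g x)) \<le> norm (f x + g x)"
        using arith_geo_mean_sqrt[of "f x" "g x"] by (simp add: abs_of_nonneg)
    qed
  qed measurable
  have "(\<integral>x. (sqrt (f x) - sqrt (g x))\<^sup>2 \<partial>\<mu>) = (\<integral>x. f x + g x - 2 * sqrt (f x * g x) \<partial>\<mu>)"
    by (rule Bochner_Integration.integral_cong)
      (auto simp: power2_diff f_nonneg g_nonneg real_sqrt_mult)
  also have "\<dots> = 2 - 2 * (\<integral>x. sqrt (f x * g x) \<partial>\<mu>)"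
    using fi gi si by simp
  finally have "(\<integral>x. sqrt (f x * g x) \<partial>\<mu>) = 1 - hellinger_sq \<mu> f g"
    unfolding hellinger_sq_def by (simp add: field_simps)
  then show ?thesis
    using nn_integral_eq_integral[OF si] by (auto simp: f_nonneg g_nonneg)
qed

text \<open>Young's inequality applied to the normalized factors. The first integral enters only
  through a positive bound \<alpha>, so dividing by a power of \<alpha> is safe even if that
  integral vanishes; the second may be infinite, as nothing bounds the prior density at a single
  parameter.\<close>

lemma nn_integral_Hoelder_le:
  fixes f g :: "'a \<Rightarrow> real" and s r \<alpha> :: real
  assumes f [measurable]: "f \<in> borel_measurable N" and g [measurable]: "g \<in> borel_measurable N"
    and f_nonneg: "\<And>x. x \<in> space N \<Longrightarrow> 0 \<le> f x" and g_nonneg: "\<And>x. x \<in> space N \<Longrightarrow> 0 \<le> g x"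
    and sr: "s > 1" "r > 1" "1 / s + 1 / r = 1" and \<alpha>: "0 < \<alpha>"
    and f_le: "(\<integral>\<^sup>+x. ennreal (f x powr s) \<partial>N) \<le> ennreal \<alpha>"
  shows "(\<integral>\<^sup>+x. ennreal (f x * g x) \<partial>N) \<le>
    ennreal (\<alpha> powr (1 / s)) * ennreal_powr (\<integral>\<^sup>+x. ennreal (g x powr r) \<partial>N) (1 / r)"
proof -
  define B where "B = (\<integral>\<^sup>+x. ennreal (g x powr r) \<partial>N)"
  \<comment> \<open>Normalizing divides by \<open>b powr (1 / r)\<close>, so the values 0 and
    infinity of \<open>B\<close> are treated separately.\<close>
  consider "B = 0" | "B = \<top>" | b where "B = ennreal b" "0 < b"
    by (cases B rule: ennreal_cases) (auto simp: less_le)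
  then show ?thesis
  proof cases
    case 1
    then have "AE x in N. g x = 0"
      unfolding B_def by (subst (asm) nn_integral_0_iff_AE) auto
    then have "(\<integral>\<^sup>+x. ennreal (f x * g x) \<partial>N) = (\<integral>\<^sup>+x. 0 \<partial>N)"
      by (intro nn_integral_cong_AE) auto
    then show ?thesis by simp
  next
    case 2
    then show ?thesis using \<alpha> sr by (simp add: B_def[symmetric] ennreal_powr_def ennreal_mult_top)
  next
    case 3
    define c where "c = \<alpha> powr (1 / s) * b powr (1 / r)"
    have c: "0 < c" using \<alpha> 3 by (simp add: c_def)
    \<comment> \<open>Young's inequality for \<open>f\<close> over
      \<open>\<alpha> powr (1 / s)\<close> and \<open>g\<close> over \<open>b powr (1 / r)\<close>,
      multiplied by \<open>c\<close>. After integration the two terms are at most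
      \<open>c / s\<close> and \<open>c / r\<close>, which add up to \<open>c\<close>.\<close>
    have pw: "f x * g x \<le> (c / (s * \<alpha>)) * f x powr s + (c / (r * b)) * g x powr r"
      if "x \<in> space N" for x
    proof -
      have "(f x / \<alpha> powr (1/s)) * (g x / b powr (1/r))
          \<le> (f x / \<alpha> powr (1/s)) powr s / s + (g x / b powr (1/r)) powr r / r"
        using sr f_nonneg[OF that] g_nonneg[OF that] by (intro Youngs_inequality) auto
      also have "\<dots> = f x powr s / (s * \<alpha>) + g x powr r / (r * b)"
        using sr f_nonneg[OF that] g_nonneg[OF that] \<alpha> 3
        by (simp add: powr_divide powr_powr mult.commute)
      finally have "c * ((f x / \<alpha> powr (1/s)) * (g x / b powr (1/r)))
          \<le> c * (f x powr s / (s * \<alpha>) + g x powr r / (r * b))"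
        using c by (intro mult_left_mono) auto
      moreover have "c * ((f x / \<alpha> powr (1/s)) * (g x / b powr (1/r))) = f x * g x"
        using \<alpha> 3 by (simp add: c_def)
      ultimately show ?thesis by (simp add: algebra_simps)
    qed
    have "(\<integral>\<^sup>+x. ennreal (f x * g x) \<partial>N) \<le>
        (\<integral>\<^sup>+x. ennreal (c / (s * \<alpha>)) * ennreal (f x powr s)
            + ennreal (c / (r * b)) * ennreal (g x powr r) \<partial>N)"
      using pw c sr \<alpha> 3
      by (intro nn_integral_mono)
        (simp add: ennreal_mult[symmetric] ennreal_plus[symmetric] ennreal_leI del: ennreal_plus)
    also have "\<dots> = ennreal (c / (s * \<alpha>)) * (\<integral>\<^sup>+x. ennreal (f x powr s) \<partial>N)
        + ennreal (c / (r * b)) * B"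
      unfolding B_def by (simp add: nn_integral_add nn_integral_cmult)
    also have "\<dots> \<le> ennreal (c / (s * \<alpha>)) * ennreal \<alpha> + ennreal (c / (r * b)) * ennreal b"
      using 3 f_le by (intro add_mono mult_left_mono) auto
    also have "\<dots> = ennreal (c * (1 / s + 1 / r))"
      using c sr \<alpha> 3
      by (simp add: ennreal_mult[symmetric] ennreal_plus[symmetric] field_simps del: ennreal_plus)
    also have "\<dots> = ennreal c" using sr by simp
    finally show ?thesis
      using 3 by (simp add: B_def[symmetric] ennreal_powr_def c_def ennreal_mult)
  qed
qed

section \<open>Bounds on the posterior at fixed data\<close>

lemma posterior_le_1: "A \<subseteq> space \<nu> \<Longrightarrow> posterior \<nu> L q A \<le> 1"
proof -
  have le: "(\<integral>\<^sup>+\<theta>\<in>A. ennreal (L \<theta> * q \<theta>) \<partial>\<nu>) \<le> (\<integral>\<^sup>+\<theta>. ennreal (L \<theta> * q \<theta>) \<partial>\<nu>)" (is "?a \<le> ?b")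
    by (intro nn_integral_mono) (auto split: split_indicator)
  have "?a / ?b \<le> ?b / ?b" by (rule divide_right_mono_ennreal[OF le])
  \<comment> \<open>For a normalizing constant 0 or infinity the quotient is 0 by
    convention.\<close>
  also have "?b / ?b \<le> 1"
    by (cases "?b = 0 \<or> ?b = \<top>") (auto simp: less_top)
  finally show ?thesis unfolding posterior_def .
qed

text \<open>\<open>Lhat\<close> stands for the maximal likelihood and \<open>L0\<close> for that of
  the truth. Numerator and denominator are both compared with \<open>Lhat\<close>, which then
  cancels. The costs are \<open>u\<close> and \<open>v\<close> for the denominator, and
  \<open>a * w\<close> for replacing \<open>Lhat\<close> by \<open>L0\<close> inside the
  power.\<close>

lemma posterior_le_fractional:
  fixes L q :: "'t \<Rightarrow> real"
  assumes L [measurable]: "L \<in> borel_measurable \<nu>" and q [measurable]: "q \<in> borel_measurable \<nu>"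
    and A [measurable]: "A \<in> sets \<nu>"
    and L_nonneg: "\<And>\<theta>. \<theta> \<in> space \<nu> \<Longrightarrow> 0 \<le> L \<theta>" and q_nonneg: "\<And>\<theta>. \<theta> \<in> space \<nu> \<Longrightarrow> 0 \<le> q \<theta>"
    and q_prob: "prob_space (prior_dist \<nu> q)"
    and L_le: "\<And>\<theta>. \<theta> \<in> space \<nu> \<Longrightarrow> L \<theta> \<le> Lhat"
    and mass: "exp (- v) \<le> measure (prior_dist \<nu> q) {\<theta> \<in> space \<nu>. exp (- u) * Lhat \<le> L \<theta>}"
    and L0: "0 < L0" "exp (- w) * L0 \<le> Lhat"
    and a: "0 \<le> a" "a \<le> 1"
  shows "posterior \<nu> L q A \<le>
    ennreal (exp (u + v + a * w)) * (\<integral>\<^sup>+\<theta>\<in>A. ennreal ((L \<theta> / L0) powr a * q \<theta>) \<partial>\<nu>)"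
proof -
  have Lhat: "0 < Lhat" using L0 by (smt (verit) exp_gt_zero mult_pos_pos)
  define I where "I = (\<integral>\<^sup>+\<theta>\<in>A. ennreal ((L \<theta> / L0) powr a * q \<theta>) \<partial>\<nu>)"
  define B where "B = {\<theta> \<in> space \<nu>. exp (- u) * Lhat \<le> L \<theta>}"
  have B [measurable]: "B \<in> sets \<nu>" unfolding B_def by measurable
  \<comment> \<open>The ratio \<open>L \<theta> / Lhat\<close> lies in [0, 1], so lowering the
    exponent from 1 to \<open>a\<close> increases it; then \<open>Lhat\<close> is replaced by its
    lower bound in terms of \<open>L0\<close>.\<close>
  have L_frac: "L \<theta> \<le> (Lhat * exp (a * w)) * (L \<theta> / L0) powr a" if "\<theta> \<in> space \<nu>" for \<theta>
  proof -
    have "L \<theta> / Lhat \<le> (L \<theta> / Lhat) powr a"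
    proof -
      have "(L \<theta> / Lhat) powr 1 \<le> (L \<theta> / Lhat) powr a"
        using L_nonneg[OF that] L_le[OF that] Lhat a by (intro powr_mono') auto
      then show ?thesis using L_nonneg[OF that] Lhat by simp
    qed
    also have "\<dots> \<le> (exp w * (L \<theta> / L0)) powr a"
    proof (rule powr_mono2)
      have "L \<theta> / Lhat \<le> L \<theta> / (exp (- w) * L0)"
        using L_nonneg[OF that] L0 Lhat by (intro divide_left_mono) auto
      then show "L \<theta> / Lhat \<le> exp w * (L \<theta> / L0)" by (simp add: exp_minus field_simps)
    qed (use L_nonneg[OF that] Lhat a in auto)
    also have "\<dots> = exp (a * w) * (L \<theta> / L0) powr a"
      using L_nonneg[OF that] L0 by (subst powr_mult) (auto simp: exp_powr_real mult.commute)
    finally show ?thesis using Lhat by (simp add: field_simps)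
  qed
  have num: "(\<integral>\<^sup>+\<theta>\<in>A. ennreal (L \<theta> * q \<theta>) \<partial>\<nu>) \<le> ennreal (Lhat * exp (a * w)) * I"
  proof -
    have "(\<integral>\<^sup>+\<theta>\<in>A. ennreal (L \<theta> * q \<theta>) \<partial>\<nu>) \<le>
        (\<integral>\<^sup>+\<theta>. ennreal (Lhat * exp (a * w)) * (ennreal ((L \<theta> / L0) powr a * q \<theta>) * indicator A \<theta>) \<partial>\<nu>)"
    proof (intro nn_integral_mono)
      fix \<theta> assume \<theta>: "\<theta> \<in> space \<nu>"
      have "ennreal (L \<theta> * q \<theta>) \<le> ennreal (((Lhat * exp (a * w)) * (L \<theta> / L0) powr a) * q \<theta>)"
        using L_frac[OF \<theta>] q_nonneg[OF \<theta>] by (intro ennreal_leI mult_right_mono)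
      then show "ennreal (L \<theta> * q \<theta>) * indicator A \<theta> \<le>
          ennreal (Lhat * exp (a * w)) * (ennreal ((L \<theta> / L0) powr a * q \<theta>) * indicator A \<theta>)"
        using Lhat q_nonneg[OF \<theta>]
        by (auto split: split_indicator simp: ennreal_mult[symmetric] mult.assoc)
    qed
    also have "\<dots> = ennreal (Lhat * exp (a * w)) * I"
      unfolding I_def by (rule nn_integral_cmult) measurable
    finally show ?thesis .
  qed
  \<comment> \<open>Restrict the integral to \<open>B\<close>: there the likelihood is at least
    \<open>exp (- u) * Lhat\<close>, and the prior mass of \<open>B\<close> is at least
    \<open>exp (- v)\<close>.\<close>
  have den: "ennreal (exp (- u - v) * Lhat) \<le> (\<integral>\<^sup>+\<theta>. ennreal (L \<theta> * q \<theta>) \<partial>\<nu>)"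
  proof -
    interpret prob_space "prior_dist \<nu> q" by fact
    have "ennreal (exp (- u - v) * Lhat) = ennreal (exp (- u) * Lhat) * ennreal (exp (- v))"
      using Lhat by (simp add: ennreal_mult[symmetric] exp_diff exp_minus field_simps)
    also have "\<dots> \<le> ennreal (exp (- u) * Lhat) * emeasure (prior_dist \<nu> q) B"
      using mass unfolding B_def by (intro mult_left_mono) (auto simp: emeasure_eq_measure)
    also have "\<dots> = (\<integral>\<^sup>+\<theta>. ennreal (exp (- u) * Lhat) * (ennreal (q \<theta>) * indicator B \<theta>) \<partial>\<nu>)"
      by (simp add: prior_dist_def emeasure_density nn_integral_cmult)
    also have "\<dots> \<le> (\<integral>\<^sup>+\<theta>. ennreal (L \<theta> * q \<theta>) \<partial>\<nu>)"
      using Lhat q_nonneg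
      by (intro nn_integral_mono)
        (auto split: split_indicator simp: B_def ennreal_mult[symmetric] intro!: ennreal_leI mult_right_mono)
    finally show ?thesis .
  qed
  have "(\<integral>\<^sup>+\<theta>\<in>A. ennreal (L \<theta> * q \<theta>) \<partial>\<nu>)
      \<le> (ennreal (exp (u + v + a * w)) * ennreal (exp (- u - v) * Lhat)) * I"
  proof -
    have "Lhat * exp (a * w) = exp (u + v + a * w) * (exp (- u - v) * Lhat)"
      by (simp add: mult.assoc[symmetric] exp_add[symmetric])
    then show ?thesis using num Lhat by (simp only: ennreal_mult[symmetric] exp_ge_zero mult_nonneg_nonneg less_imp_le)
  qed
  also have "\<dots> \<le> (ennreal (exp (u + v + a * w)) * (\<integral>\<^sup>+\<theta>. ennreal (L \<theta> * q \<theta>) \<partial>\<nu>)) * I"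
    by (intro mult_right_mono mult_left_mono den) auto
  finally have "(\<integral>\<^sup>+\<theta>\<in>A. ennreal (L \<theta> * q \<theta>) \<partial>\<nu>)
      \<le> (\<integral>\<^sup>+\<theta>. ennreal (L \<theta> * q \<theta>) \<partial>\<nu>) * (ennreal (exp (u + v + a * w)) * I)"
    by (simp add: mult_ac)
  \<comment> \<open>Positivity suffices for the division: an infinite denominator makes the quotient
    0.\<close>
  moreover have "0 < (\<integral>\<^sup>+\<theta>. ennreal (L \<theta> * q \<theta>) \<partial>\<nu>)"
    using Lhat by (intro less_le_trans[OF _ den]) simp
  ultimately show ?thesis
    unfolding posterior_def I_def by (intro divide_le_posI_ennreal)
qed

section \<open>Chebyshev bound for the log-likelihood ratio\<close>

text \<open>On the event the log-likelihood ratio exceeds \<open>w\<close>, so its square exceeds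
  \<open>w\<^sup>2\<close>; Markov's inequality for the square, whose expectation is
  \<open>kl_var\<close>, gives the bound.\<close>

lemma small_likelihood_prob_le_kl_var:
  assumes f [measurable]: "f \<in> borel_measurable \<mu>" and g [measurable]: "g \<in> borel_measurable \<mu>"
    and f_nonneg: "\<And>x. x \<in> space \<mu> \<Longrightarrow> 0 \<le> f x" and g_nonneg: "\<And>x. x \<in> space \<mu> \<Longrightarrow> 0 \<le> g x"
    and var: "kl_var \<mu> f g \<le> ereal \<rho>" and pos: "0 < \<rho>" "0 < w"
  shows "emeasure (data_dist \<mu> f) {x \<in> space \<mu>. g x < exp (- w) * f x} \<le> ennreal (\<rho> / w\<^sup>2)"
proof -
  let ?B = "{x \<in> space \<mu>. g x < exp (- w) * f x}"
  have B [measurable]: "?B \<in> sets \<mu>" by measurable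
  have "ennreal (w\<^sup>2) * emeasure (data_dist \<mu> f) ?B = (\<integral>\<^sup>+x. ennreal (w\<^sup>2) * (ennreal (f x) * indicator ?B x) \<partial>\<mu>)"
    by (simp add: data_dist_def emeasure_density nn_integral_cmult)
  also have "\<dots> \<le> (\<integral>\<^sup>+x. e2ennreal ((log_ratio (f x) (g x))\<^sup>2 * ereal (f x)) \<partial>\<mu>)"
  proof (rule nn_integral_mono)
    fix x assume x: "x \<in> space \<mu>"
    show "ennreal (w\<^sup>2) * (ennreal (f x) * indicator ?B x) \<le>
      e2ennreal ((log_ratio (f x) (g x))\<^sup>2 * ereal (f x))"
    proof (cases "x \<in> ?B")
      case True
      then have lt: "g x < exp (- w) * f x" by simp
      have fx: "0 < f x" using lt g_nonneg[OF x] by (smt (verit) exp_gt_zero zero_less_mult_iff)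
      have "ereal (w\<^sup>2 * f x) \<le> (log_ratio (f x) (g x))\<^sup>2 * ereal (f x)"
      \<comment> \<open>Where \<open>g\<close> vanishes and \<open>f\<close> does not,
        \<open>log_ratio\<close> is infinite and the bound is trivial.\<close>
      proof (cases "g x = 0")
        case True
        then show ?thesis using fx by (simp add: log_ratio_def power2_eq_square)
      next
        case False
        then have gx: "0 < g x" using g_nonneg[OF x] by simp
        have "exp w < f x / g x" using lt gx by (simp add: exp_minus field_simps)
        then have "w \<le> ln (f x / g x)" using fx gx by (simp add: ln_ge_iff less_imp_le)
        then have "w\<^sup>2 \<le> (ln (f x / g x))\<^sup>2" using pos by (intro power_mono) auto
        then show ?thesis using fx gx
          by (simp add: log_ratio_def power2_eq_square mult_right_mono)
      qed
      then have "e2ennreal (ereal (w\<^sup>2 * f x)) \<le> e2ennreal ((log_ratio (f x) (g x))\<^sup>2 * ereal (f x))"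
        by (rule e2ennreal_mono)
      moreover have "ennreal (w\<^sup>2) * (ennreal (f x) * indicator ?B x) = ennreal (w\<^sup>2 * f x)"
        using True fx by (simp add: ennreal_mult)
      ultimately show ?thesis by (simp only: e2ennreal_ereal)
    qed simp
  qed
  also have "\<dots> \<le> ennreal \<rho>"
    using e2ennreal_mono[OF var] unfolding kl_var_def by (simp only: e2ennreal_enn2ereal e2ennreal_ereal)
  finally have "ennreal (w\<^sup>2) * emeasure (data_dist \<mu> f) ?B \<le> ennreal (w\<^sup>2) * ennreal (\<rho> / w\<^sup>2)"
    using pos by (simp add: ennreal_mult[symmetric])
  then show ?thesis
    using pos by (subst (asm) ennreal_mult_le_mult_iff) auto
qed

section \<open>Expected posterior mass of the far set at a fixed sample size\<close>

text \<open>The first two terms are the probabilities of the bad events: failure of (LP1), and a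
  small likelihood at \<open>td\<close>. In the last exponent, \<open>d + C\<close> comes from the
  normalizing constant, \<open>m / (2 * s)\<close> from passing from the maximal likelihood to that
  of the truth, \<open>K\<close> from (GP1), and \<open>- m\<^sup>2 / s\<close> from the Hellinger
  separation.\<close>

lemma (in empirical_bayes_sieve) expected_posterior_far_le:
  fixes \<rho> e m d C K r s :: real
  defines "P n \<equiv> data_dist (\<mu> n) (p n \<theta>s)"
  assumes n: "n \<ge> 1" and \<rho>: "real n * e\<^sup>2 = \<rho>" "0 < \<rho>"
    and td: "td \<in> S n" "kl_var (\<mu> n) (p n \<theta>s) (p n td) \<le> ereal \<rho>"
    and m: "0 < m" and rs: "1 < s" "1 < r" "1 / s + 1 / r = 1"
    and G: "(\<integral>\<^sup>+\<theta>. ennreal_powr (\<integral>\<^sup>+x. ennreal (q n x \<theta> powr r) \<partial>P n) (1 / r) \<partial>\<nu> n)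
      \<le> ennreal (exp (K * \<rho>))"
  shows "expected_posterior_far \<mu> p \<Theta> \<theta>s S \<nu> q n m e \<le>
      ennreal (measure (P n) {x \<in> space (\<mu> n). measure (prior_dist (\<nu> n) (q n x))
          (high_likelihood_set (p n) (S n) (\<theta>hat n) (d * \<rho>) x) < exp (- (C * \<rho>))})
    + ennreal (1 / (m\<^sup>2 * \<rho>)) + ennreal (exp ((d + C + K + m / (2 * s) - m\<^sup>2 / s) * \<rho>))"
proof -
  interpret MU: sigma_finite_measure "\<mu> n" by (rule mu_sigma_finite[OF n])
  interpret NU: sigma_finite_measure "\<nu> n" by (rule nu_sigma_finite[OF n])
  interpret P: prob_space "P n" unfolding P_def by (rule p_prob[OF n true_parameter])
  interpret PN: pair_sigma_finite "P n" "\<nu> n" ..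
  note ps [measurable] = p_measurable[OF n true_parameter]
  have sets_P [measurable_cong, simp]: "sets (P n) = sets (\<mu> n)" by (simp add: P_def data_dist_def)
  have space_P [simp]: "space (P n) = space (\<mu> n)" by (simp add: P_def data_dist_def)
  note [simp] = nu_space[OF n]
  have td\<Theta>: "td \<in> \<Theta>" using td sieve_subset[OF n] by auto
  note ptd [measurable] = p_measurable[OF n td\<Theta>]
  note pj [measurable] = p_jointly_measurable[OF n]
  note qj [measurable] = prior_jointly_measurable[OF n]
  note Lh [measurable] = max_likelihood_measurable[OF n]
  define A where "A = far_set \<mu> p \<Theta> \<theta>s n m e \<inter> S n"
  \<comment> \<open>Chosen so that \<open>a * s = 1 / 2\<close>: Hoelder's inequality then produces
    the Hellinger affinity.\<close>
  define a where "a = 1 / (2 * s)"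
  define D where "D = d * \<rho> + C * \<rho> + a * (m * \<rho>)"
  define HL where "HL = high_likelihood_set (p n) (S n) (\<theta>hat n) (d * \<rho>)"
  define B1 where "B1 = {x \<in> space (\<mu> n). measure (prior_dist (\<nu> n) (q n x)) (HL x) < exp (- (C * \<rho>))}"
  define B2 where "B2 = {x \<in> space (\<mu> n). p n td x < exp (- (m * \<rho>)) * p n \<theta>s x}"
  define F where "F x \<theta> = (p n \<theta> x / p n \<theta>s x) powr a * q n x \<theta>" for x \<theta>
  have a: "0 \<le> a" "a \<le> 1" using rs by (auto simp: a_def)
  have p_meas: "(\<lambda>\<theta>. p n \<theta> x) \<in> borel_measurable (\<nu> n)" if "x \<in> space (\<mu> n)" for x
    using measurable_compose_Pair1[OF that pj] by simp
  have q_meas: "(\<lambda>\<theta>. q n x \<theta>) \<in> borel_measurable (\<nu> n)" if "x \<in> space (\<mu> n)" for x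
    using measurable_compose_Pair1[OF that qj] by simp
  have q_meas': "(\<lambda>x. q n x \<theta>) \<in> borel_measurable (\<mu> n)" if "\<theta> \<in> S n" for \<theta>
    using measurable_compose[OF measurable_Pair2'[of \<theta> "\<nu> n" "\<mu> n"] qj] that by simp
  \<comment> \<open>The Hellinger distance is a parameter integral of a jointly measurable function,
    hence measurable in the parameter.\<close>
  have [measurable]: "A \<in> sets (\<nu> n)"
  proof -
    have "(\<lambda>(\<theta>, x). p n \<theta> x) \<in> borel_measurable (\<nu> n \<Otimes>\<^sub>M \<mu> n)"
      using measurable_pair_swap[OF pj] by (simp add: case_prod_beta')
    then have [measurable]: "(\<lambda>\<theta>. hellinger_sq (\<mu> n) (p n \<theta>s) (p n \<theta>)) \<in> borel_measurable (\<nu> n)"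
      unfolding hellinger_sq_def by measurable
    have eq: "A = {\<theta> \<in> space (\<nu> n). hellinger_sq (\<mu> n) (p n \<theta>s) (p n \<theta>) > 1 - exp (- (m\<^sup>2 * real n * e\<^sup>2))}"
      using sieve_subset[OF n] by (auto simp: A_def far_set_def)
    show ?thesis unfolding eq by measurable
  qed
  \<comment> \<open>The set \<open>HL x\<close> depends on the data, so its prior mass is written as
    an integral over all of \<open>S n\<close> with a jointly measurable indicator; measurability of
    the maximal likelihood enters here.\<close>
  have [measurable]: "B1 \<in> sets (\<mu> n)"
  proof -
    have "measure (prior_dist (\<nu> n) (q n x)) (HL x) =
        enn2real (\<integral>\<^sup>+\<theta>. ennreal (q n x \<theta>) *
          (if exp (- (d * \<rho>)) * p n (\<theta>hat n x) x \<le> p n \<theta> x then 1 else 0) \<partial>\<nu> n)" if x: "x \<in> space (\<mu> n)" for x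
    proof -
      note [measurable] = p_meas[OF x] q_meas[OF x]
      have HL: "HL x = {\<theta> \<in> space (\<nu> n). exp (- (d * \<rho>)) * p n (\<theta>hat n x) x \<le> p n \<theta> x}"
        by (auto simp: HL_def high_likelihood_set_def)
      also have "\<dots> \<in> sets (\<nu> n)" by measurable
      finally have "HL x \<in> sets (\<nu> n)" .
      then show ?thesis
        unfolding measure_def prior_dist_def
        by (subst emeasure_density) (auto simp: HL intro!: arg_cong[where f=enn2real] nn_integral_cong split: split_indicator)
    qed
    then have "(\<lambda>x. measure (prior_dist (\<nu> n) (q n x)) (HL x)) \<in> borel_measurable (\<mu> n)"
      by (subst measurable_cong) measurable
    then show ?thesis unfolding B1_def by measurable
  qed
  have [measurable]: "B2 \<in> sets (\<mu> n)" unfolding B2_def by measurable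
  have F_meas [measurable]: "case_prod F \<in> borel_measurable (\<mu> n \<Otimes>\<^sub>M \<nu> n)"
    unfolding F_def by measurable
  have ps_pos: "AE x in P n. 0 < p n \<theta>s x"
    unfolding P_def data_dist_def by (subst AE_density) auto
  \<comment> \<open>On the bad events the posterior is bounded by 1; elsewhere the fractional bound
    applies with \<open>u = d * \<rho>\<close>, \<open>v = C * \<rho>\<close>,
    \<open>w = m * \<rho>\<close>. Positivity of the true density and maximality of
    \<open>\<theta>hat\<close> hold almost surely.\<close>
  have ae: "AE x in P n. posterior (\<nu> n) (\<lambda>\<theta>. p n \<theta> x) (q n x) A \<le>
      indicator B1 x + indicator B2 x + ennreal (exp D) * (\<integral>\<^sup>+\<theta>\<in>A. ennreal (F x \<theta>) \<partial>\<nu> n)"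
    using ps_pos mle[OF n, folded P_def] AE_space
  proof eventually_elim
    case (elim x)
    then have x: "x \<in> space (\<mu> n)" by simp
    show ?case
    proof (cases "x \<in> B1 \<union> B2")
      case True
      have "posterior (\<nu> n) (\<lambda>\<theta>. p n \<theta> x) (q n x) A \<le> 1"
        by (rule posterior_le_1) (auto simp: A_def)
      also have "1 \<le> (indicator B1 x + indicator B2 x :: ennreal)"
        using True by (auto split: split_indicator)
      finally show ?thesis by (simp add: add_increasing2)
    next
      case False
      have le_max: "p n \<theta> x \<le> p n (\<theta>hat n x) x" if "\<theta> \<in> S n" for \<theta>
        using elim(2) that by (auto simp: is_arg_max_def not_less)
      have HL: "{\<theta> \<in> space (\<nu> n). exp (- (d * \<rho>)) * p n (\<theta>hat n x) x \<le> p n \<theta> x} = HL x"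
        by (auto simp: HL_def high_likelihood_set_def)
      have "posterior (\<nu> n) (\<lambda>\<theta>. p n \<theta> x) (q n x) A \<le> ennreal (exp D) * (\<integral>\<^sup>+\<theta>\<in>A. ennreal (F x \<theta>) \<partial>\<nu> n)"
        unfolding D_def F_def
      proof (rule posterior_le_fractional[where Lhat = "p n (\<theta>hat n x) x"])
        show "exp (- (C * \<rho>)) \<le> measure (prior_dist (\<nu> n) (q n x))
            {\<theta> \<in> space (\<nu> n). exp (- (d * \<rho>)) * p n (\<theta>hat n x) x \<le> p n \<theta> x}"
          unfolding HL using False x by (auto simp: B1_def)
        \<comment> \<open>Since \<open>td\<close> lies in the sieve, the maximal likelihood
          dominates that of \<open>td\<close>, which is large enough off \<open>B2\<close>.\<close>
        show "exp (- (m * \<rho>)) * p n \<theta>s x \<le> p n (\<theta>hat n x) x"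
          using False x le_max[OF td(1)] by (auto simp: B2_def)
      qed (use p_meas[OF x] q_meas[OF x] x elim le_max a n sieve_subset[OF n] in
            \<open>auto intro: p_nonneg prior_nonneg prior_prob\<close>)
      then show ?thesis by (rule order_trans) simp
    qed
  qed
  have swap: "(\<integral>\<^sup>+x. (\<integral>\<^sup>+\<theta>\<in>A. ennreal (F x \<theta>) \<partial>\<nu> n) \<partial>P n) \<le> ennreal (exp (K * \<rho> - m\<^sup>2 / s * \<rho>))"
  proof -
    have "(\<integral>\<^sup>+x. (\<integral>\<^sup>+\<theta>\<in>A. ennreal (F x \<theta>) \<partial>\<nu> n) \<partial>P n) =
        (\<integral>\<^sup>+\<theta>. (\<integral>\<^sup>+x. ennreal (F x \<theta>) * indicator A \<theta> \<partial>P n) \<partial>\<nu> n)"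
      by (rule PN.Fubini'[symmetric]) measurable
    \<comment> \<open>Hoelder in the data for each fixed parameter in \<open>A\<close>. The constant
      no longer depends on the parameter, so what remains is the integral in (GP1).\<close>
    also have "\<dots> \<le> (\<integral>\<^sup>+\<theta>. ennreal (exp (- (m\<^sup>2 * \<rho>)) powr (1 / s)) *
        ennreal_powr (\<integral>\<^sup>+x. ennreal (q n x \<theta> powr r) \<partial>P n) (1 / r) \<partial>\<nu> n)"
    proof (rule nn_integral_mono)
      fix \<theta> assume "\<theta> \<in> space (\<nu> n)"
      then have \<theta>: "\<theta> \<in> S n" "\<theta> \<in> \<Theta>" using sieve_subset[OF n] by auto
      note [measurable] = p_measurable[OF n \<theta>(2)] q_meas'[OF \<theta>(1)]
      show "(\<integral>\<^sup>+x. ennreal (F x \<theta>) * indicator A \<theta> \<partial>P n) \<le> ennreal (exp (- (m\<^sup>2 * \<rho>)) powr (1 / s)) *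
        ennreal_powr (\<integral>\<^sup>+x. ennreal (q n x \<theta> powr r) \<partial>P n) (1 / r)"
      proof (cases "\<theta> \<in> A")
        case True
        have "(\<integral>\<^sup>+x. ennreal (((p n \<theta> x / p n \<theta>s x) powr a) powr s) \<partial>P n) =
            (\<integral>\<^sup>+x. ennreal (p n \<theta>s x) * ennreal (((p n \<theta> x / p n \<theta>s x) powr a) powr s) \<partial>\<mu> n)"
          unfolding P_def data_dist_def by (subst nn_integral_density) auto
        also have "\<dots> = (\<integral>\<^sup>+x. ennreal (sqrt (p n \<theta>s x * p n \<theta> x)) \<partial>\<mu> n)"
        proof (rule nn_integral_cong)
          fix x assume x: "x \<in> space (\<mu> n)"
          have nn: "0 \<le> p n \<theta> x" "0 \<le> p n \<theta>s x"
            using p_nonneg[OF n _ x] \<theta> true_parameter by auto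
          have "((p n \<theta> x / p n \<theta>s x) powr a) powr s = sqrt (p n \<theta> x / p n \<theta>s x)"
            using nn rs by (simp add: powr_powr a_def powr_half_sqrt)
          \<comment> \<open>This also holds where the true density is 0: both sides are then
            0.\<close>
          moreover have "p n \<theta>s x * sqrt (p n \<theta> x / p n \<theta>s x) = sqrt (p n \<theta>s x * p n \<theta> x)"
          proof -
            have "p n \<theta>s x * sqrt (p n \<theta> x / p n \<theta>s x) = (p n \<theta>s x / sqrt (p n \<theta>s x)) * sqrt (p n \<theta> x)"
              by (simp add: real_sqrt_divide)
            then show ?thesis using nn by (simp add: real_div_sqrt real_sqrt_mult)
          qed
          ultimately show "ennreal (p n \<theta>s x) * ennreal (((p n \<theta> x / p n \<theta>s x) powr a) powr s)
              = ennreal (sqrt (p n \<theta>s x * p n \<theta> x))"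
            using nn by (simp add: ennreal_mult[symmetric])
        qed
        also have "\<dots> = ennreal (1 - hellinger_sq (\<mu> n) (p n \<theta>s) (p n \<theta>))"
          using \<theta> true_parameter n
          by (intro nn_integral_sqrt_mult_hellinger) (auto intro: p_nonneg p_prob)
        also have "\<dots> \<le> ennreal (exp (- (m\<^sup>2 * \<rho>)))"
          using True by (intro ennreal_leI) (auto simp: A_def far_set_def \<rho>(1)[symmetric] mult.assoc)
        finally have "(\<integral>\<^sup>+x. ennreal ((p n \<theta> x / p n \<theta>s x) powr a * q n x \<theta>) \<partial>P n) \<le>
            ennreal (exp (- (m\<^sup>2 * \<rho>)) powr (1 / s)) *
            ennreal_powr (\<integral>\<^sup>+x. ennreal (q n x \<theta> powr r) \<partial>P n) (1 / r)"
          using rs \<theta> n by (intro nn_integral_Hoelder_le) (auto intro: prior_nonneg)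
        then show ?thesis using True by (simp add: F_def)
      qed simp
    qed
    also have "\<dots> = ennreal (exp (- (m\<^sup>2 * \<rho>)) powr (1 / s)) *
        (\<integral>\<^sup>+\<theta>. ennreal_powr (\<integral>\<^sup>+x. ennreal (q n x \<theta> powr r) \<partial>P n) (1 / r) \<partial>\<nu> n)"
    proof (rule nn_integral_cmult)
      have "(\<lambda>(\<theta>, x). q n x \<theta>) \<in> borel_measurable (\<nu> n \<Otimes>\<^sub>M \<mu> n)"
        using measurable_pair_swap[OF qj] by (simp add: case_prod_beta')
      then have [measurable]: "(\<lambda>(\<theta>, x). q n x \<theta>) \<in> borel_measurable (\<nu> n \<Otimes>\<^sub>M P n)"
        by (simp cong: measurable_cong_sets sets_pair_measure_cong)
      show "(\<lambda>\<theta>. ennreal_powr (\<integral>\<^sup>+x. ennreal (q n x \<theta> powr r) \<partial>P n) (1 / r)) \<in> borel_measurable (\<nu> n)"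
        unfolding ennreal_powr_def by measurable
    qed
    also have "\<dots> \<le> ennreal (exp (- (m\<^sup>2 * \<rho>)) powr (1 / s)) * ennreal (exp (K * \<rho>))"
      using G by (rule mult_left_mono) simp
    also have "\<dots> = ennreal (exp (K * \<rho> - m\<^sup>2 / s * \<rho>))"
      by (simp add: ennreal_mult[symmetric] exp_powr_real exp_add[symmetric])
    finally show ?thesis .
  qed
  have "expected_posterior_far \<mu> p \<Theta> \<theta>s S \<nu> q n m e
      = (\<integral>\<^sup>+x. posterior (\<nu> n) (\<lambda>\<theta>. p n \<theta> x) (q n x) A \<partial>P n)"
    by (simp add: expected_posterior_far_def A_def P_def)
  also have "\<dots> \<le> (\<integral>\<^sup>+x. indicator B1 x + indicator B2 x + ennreal (exp D) * (\<integral>\<^sup>+\<theta>\<in>A. ennreal (F x \<theta>) \<partial>\<nu> n) \<partial>P n)"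
    by (rule nn_integral_mono_AE[OF ae])
  also have "\<dots> = emeasure (P n) B1 + emeasure (P n) B2
      + ennreal (exp D) * (\<integral>\<^sup>+x. (\<integral>\<^sup>+\<theta>\<in>A. ennreal (F x \<theta>) \<partial>\<nu> n) \<partial>P n)"
    by (simp add: nn_integral_add nn_integral_cmult)
  also have "\<dots> \<le> ennreal (measure (P n) B1) + ennreal (1 / (m\<^sup>2 * \<rho>))
      + ennreal (exp D) * ennreal (exp (K * \<rho> - m\<^sup>2 / s * \<rho>))"
  proof (intro add_mono mult_left_mono swap)
    \<comment> \<open>Chebyshev at the level \<open>m * \<rho>\<close> with second moment at most
      \<rho>.\<close>
    have "emeasure (P n) B2 \<le> ennreal (\<rho> / (m * \<rho>)\<^sup>2)"
      unfolding B2_def P_def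
      using n td td\<Theta> true_parameter m \<rho>(2)
      by (intro small_likelihood_prob_le_kl_var) (auto intro: p_nonneg)
    also have "\<rho> / (m * \<rho>)\<^sup>2 = 1 / (m\<^sup>2 * \<rho>)"
      using m \<rho>(2) by (simp add: power2_eq_square field_simps)
    finally show "emeasure (P n) B2 \<le> ennreal (1 / (m\<^sup>2 * \<rho>))" .
  qed (auto simp: P.emeasure_eq_measure)
  also have "ennreal (exp D) * ennreal (exp (K * \<rho> - m\<^sup>2 / s * \<rho>))
      = ennreal (exp ((d + C + K + m / (2 * s) - m\<^sup>2 / s) * \<rho>))"
    by (simp add: ennreal_mult[symmetric] exp_add[symmetric] D_def a_def algebra_simps)
  finally show ?thesis unfolding B1_def HL_def .
qed

section \<open>Passage to the limit\<close>

text \<open>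
  For large \<open>m\<close> the quadratic term \<open>m\<^sup>2 / s\<close> dominates all the other terms of the exponent. Hence
  the two regimes of the theorem only have to provide \<open>m\<^sup>2 n \<epsilon>\<^sup>2 \<rightarrow> \<infinity>\<close>.
\<close>

lemma (in empirical_bayes_sieve) expected_posterior_far_tendsto_0:
  assumes eps_pos: "\<And>n. n \<ge> 1 \<Longrightarrow> 0 < \<epsilon> n"
    and S1: "cond_S1 \<mu> p \<theta>s S \<epsilon>"
    and LP1: "cond_LP1 \<mu> p \<theta>s S \<nu> \<theta>hat q \<epsilon>"
    and GP1: "cond_GP1 \<mu> p \<theta>s \<nu> q \<epsilon>"
  shows "\<exists>M0>0. \<forall>m. eventually (\<lambda>n. M0 \<le> m n) sequentially \<longrightarrow>
      filterlim (\<lambda>n. (m n)\<^sup>2 * (real n * (\<epsilon> n)\<^sup>2)) at_top sequentially \<longrightarrow>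
      (\<lambda>n. expected_posterior_far \<mu> p \<Theta> \<theta>s S \<nu> q n (m n) (\<epsilon> n)) \<longlonglongrightarrow> 0"
proof -
  obtain td where td: "\<And>n. n \<ge> 1 \<Longrightarrow> td n \<in> S n" and ev_td: "\<forall>\<^sub>F n in sequentially.
      max (kl_div (\<mu> n) (p n \<theta>s) (p n (td n))) (kl_var (\<mu> n) (p n \<theta>s) (p n (td n)))
        \<le> ereal (real n * (\<epsilon> n)\<^sup>2)"
    using S1 unfolding cond_S1_def by blast
  obtain d C where dC: "0 < d" "0 < C" and LP: "(\<lambda>n. measure (data_dist (\<mu> n) (p n \<theta>s))
           {x \<in> space (\<mu> n).
              measure (prior_dist (\<nu> n) (q n x))
                (high_likelihood_set (p n) (S n) (\<theta>hat n) (d * real n * (\<epsilon> n)\<^sup>2) x)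
              < exp (- (C * real n * (\<epsilon> n)\<^sup>2))}) \<longlonglongrightarrow> 0" (is "?lp \<longlonglongrightarrow> 0")
    using LP1 unfolding cond_LP1_def by blast
  obtain K r where K: "0 < K" and r: "1 < r" and GP: "\<And>n. n \<ge> 1 \<Longrightarrow>
        (\<integral>\<^sup>+\<theta>. ennreal_powr
                 (\<integral>\<^sup>+x. ennreal (q n x \<theta> powr r) \<partial>data_dist (\<mu> n) (p n \<theta>s)) (1 / r) \<partial>\<nu> n)
          \<le> ennreal (exp (K * real n * (\<epsilon> n)\<^sup>2))"
    using GP1 unfolding cond_GP1_def by blast
  \<comment> \<open>The exponent conjugate to \<open>r\<close>.\<close>
  define s where "s = r / (r - 1)"
  have s: "1 < s" "1 / s + 1 / r = 1" using r by (auto simp: s_def field_simps)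
  \<comment> \<open>For \<open>m \<ge> M0\<close> this gives
    \<open>m\<^sup>2 \<ge> m + 2 * s * (d + C + K)\<close>. Thus half of the quadratic term absorbs
    the positive ones and the other half remains.\<close>
  define M0 where "M0 = 1 + 2 * s * (d + C + K)"
  have M0: "1 < M0" using s dC K by (simp add: M0_def)
  have exponent: "d + C + K + m / (2 * s) - m\<^sup>2 / s \<le> - (m\<^sup>2 / (2 * s))" if "M0 \<le> m" for m
  proof -
    have "m * (1 + 2 * s * (d + C + K)) \<le> m * m"
      using that M0 by (intro mult_left_mono) (auto simp: M0_def)
    moreover have "1 * (2 * s * (d + C + K)) \<le> m * (2 * s * (d + C + K))"
      using that M0 s dC K by (intro mult_right_mono) auto
    ultimately have "2 * s * (d + C + K) + m \<le> m\<^sup>2" by (simp add: power2_eq_square algebra_simps)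
    then have "(2 * s * (d + C + K) + m) / (2 * s) \<le> m\<^sup>2 / (2 * s)"
      using s by (intro divide_right_mono) auto
    then show ?thesis using s(1) by (simp add: add_divide_distrib)
  qed
  have "(\<lambda>n. expected_posterior_far \<mu> p \<Theta> \<theta>s S \<nu> q n (m n) (\<epsilon> n)) \<longlonglongrightarrow> 0"
    if mM: "eventually (\<lambda>n. M0 \<le> m n) sequentially"
      and lim: "filterlim (\<lambda>n. (m n)\<^sup>2 * (real n * (\<epsilon> n)\<^sup>2)) at_top sequentially" for m
  proof -
    \<comment> \<open>Both remaining error terms are controlled by \<open>w\<close>: the Chebyshev
      term is \<open>1 / w n\<close> and the exponential one at most
      \<open>exp (- w n / (2 * s))\<close>.\<close>
    define w where "w n = (m n)\<^sup>2 * (real n * (\<epsilon> n)\<^sup>2)" for n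
    have w: "filterlim w at_top sequentially" unfolding w_def[abs_def] by (rule lim)
    have "(\<lambda>n. 1 / w n) \<longlonglongrightarrow> 0"
      using w by (intro tendsto_divide_0[OF tendsto_const] filterlim_at_top_imp_at_infinity)
    moreover have "(\<lambda>n. exp (- (1 / (2 * s)) * w n)) \<longlonglongrightarrow> 0"
    proof (rule filterlim_compose[OF exp_at_bot])
      show "filterlim (\<lambda>n. - (1 / (2 * s)) * w n) at_bot sequentially"
        using s by (intro filterlim_tendsto_neg_mult_at_bot[OF tendsto_const _ w]) auto
    qed
    ultimately have "(\<lambda>n. ?lp n + 1 / w n + exp (- (1 / (2 * s)) * w n)) \<longlonglongrightarrow> 0 + 0 + 0"
      by (intro tendsto_add LP)
    from tendsto_ennrealI[OF this]
    have lim0: "(\<lambda>n. ennreal (?lp n + 1 / w n + exp (- (1 / (2 * s)) * w n))) \<longlonglongrightarrow> 0"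
      by (simp only: add_0_left ennreal_0)
    have "\<forall>\<^sub>F n in sequentially. expected_posterior_far \<mu> p \<Theta> \<theta>s S \<nu> q n (m n) (\<epsilon> n)
        \<le> ennreal (?lp n + 1 / w n + exp (- (1 / (2 * s)) * w n))"
      using mM ev_td eventually_ge_at_top[of 1]
    proof eventually_elim
      case (elim n)
      let ?\<rho> = "real n * (\<epsilon> n)\<^sup>2"
      have \<rho>: "0 < ?\<rho>" using eps_pos[of n] elim by simp
      have wn: "0 \<le> w n" by (simp add: w_def)
      have "expected_posterior_far \<mu> p \<Theta> \<theta>s S \<nu> q n (m n) (\<epsilon> n) \<le> ennreal (?lp n)
          + ennreal (1 / ((m n)\<^sup>2 * ?\<rho>)) + ennreal (exp ((d + C + K + m n / (2 * s) - (m n)\<^sup>2 / s) * ?\<rho>))"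
        using expected_posterior_far_le[of n "\<epsilon> n" ?\<rho> "td n" "m n" s r K d C]
          elim M0 s r \<rho> td GP by (simp add: mult.assoc)
      also have "\<dots> \<le> ennreal (?lp n) + ennreal (1 / w n) + ennreal (exp (- (1 / (2 * s)) * w n))"
      proof (intro add_mono ennreal_leI)
        have "(d + C + K + m n / (2 * s) - (m n)\<^sup>2 / s) * ?\<rho> \<le> - ((m n)\<^sup>2 / (2 * s)) * ?\<rho>"
          using \<rho> by (intro mult_right_mono exponent elim) auto
        also have "\<dots> = - (1 / (2 * s)) * w n" by (simp add: w_def)
        finally show "exp ((d + C + K + m n / (2 * s) - (m n)\<^sup>2 / s) * ?\<rho>) \<le> exp (- (1 / (2 * s)) * w n)"
          by simp
      qed (auto simp: w_def)
      also have "\<dots> = ennreal (?lp n + 1 / w n + exp (- (1 / (2 * s)) * w n))"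
        using wn by simp
      finally show ?case .
    qed
    then show ?thesis
      by (intro tendsto_sandwich[OF _ _ tendsto_const lim0]) auto
  qed
  then show ?thesis using M0 by (intro exI[of _ M0]) auto
qed

section \<open>The two regimes of the rate\<close>

theorem theorem1:
  fixes \<mu> :: "nat \<Rightarrow> 'x measure"
    and p :: "nat \<Rightarrow> 't \<Rightarrow> 'x \<Rightarrow> real"
    and \<Theta> :: "'t set"
    and \<theta>s :: 't
    and S :: "nat \<Rightarrow> 't set"
    and \<nu> :: "nat \<Rightarrow> 't measure"
    and \<theta>hat :: "nat \<Rightarrow> 'x \<Rightarrow> 't"
    and q :: "nat \<Rightarrow> 'x \<Rightarrow> 't \<Rightarrow> real"
    and \<epsilon> :: "nat \<Rightarrow> real"
  assumes setting: "empirical_bayes_sieve \<mu> p \<Theta> \<theta>s S \<nu> \<theta>hat q"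
    and eps_pos: "\<And>n. n \<ge> 1 \<Longrightarrow> 0 < \<epsilon> n"
    and eps_lim: "\<epsilon> \<longlonglongrightarrow> 0"
    and S1: "cond_S1 \<mu> p \<theta>s S \<epsilon>"
    and LP1: "cond_LP1 \<mu> p \<theta>s S \<nu> \<theta>hat q \<epsilon>"
    and GP1: "cond_GP1 \<mu> p \<theta>s \<nu> q \<epsilon>"
  shows "(filterlim (\<lambda>n. real n * (\<epsilon> n)\<^sup>2) at_top sequentially \<longrightarrow>
            (\<exists>M>0. (\<lambda>n. expected_posterior_far \<mu> p \<Theta> \<theta>s S \<nu> q n M (\<epsilon> n)) \<longlonglongrightarrow> 0))
       \<and> (\<epsilon> \<in> O(\<lambda>n. real n powr (- 1 / 2)) \<and> \<epsilon> \<in> \<Omega>(\<lambda>n. real n powr (- 1 / 2)) \<longrightarrow>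
            (\<forall>M :: nat \<Rightarrow> real. filterlim M at_top sequentially \<longrightarrow>
               (\<lambda>n. expected_posterior_far \<mu> p \<Theta> \<theta>s S \<nu> q n (M n) (\<epsilon> n)) \<longlonglongrightarrow> 0))"
proof -
  interpret empirical_bayes_sieve \<mu> p \<Theta> \<theta>s S \<nu> \<theta>hat q by (rule setting)
  obtain M0 where M0: "0 < M0"
    and conv: "\<forall>m. eventually (\<lambda>n. M0 \<le> m n) sequentially \<longrightarrow>
      filterlim (\<lambda>n. (m n)\<^sup>2 * (real n * (\<epsilon> n)\<^sup>2)) at_top sequentially \<longrightarrow>
      (\<lambda>n. expected_posterior_far \<mu> p \<Theta> \<theta>s S \<nu> q n (m n) (\<epsilon> n)) \<longlonglongrightarrow> 0"
    using expected_posterior_far_tendsto_0[OF eps_pos S1 LP1 GP1] by blast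
  show ?thesis
  proof (intro conjI impI allI)
    assume "filterlim (\<lambda>n. real n * (\<epsilon> n)\<^sup>2) at_top sequentially"
    then have "filterlim (\<lambda>n. M0\<^sup>2 * (real n * (\<epsilon> n)\<^sup>2)) at_top sequentially"
      using M0 by (intro filterlim_tendsto_pos_mult_at_top[OF tendsto_const]) auto
    \<comment> \<open>The radius is the constant sequence \<open>M0\<close>.\<close>
    then have "(\<lambda>n. expected_posterior_far \<mu> p \<Theta> \<theta>s S \<nu> q n M0 (\<epsilon> n)) \<longlonglongrightarrow> 0"
      by (intro conv[rule_format]) auto
    then show "\<exists>M>0. (\<lambda>n. expected_posterior_far \<mu> p \<Theta> \<theta>s S \<nu> q n M (\<epsilon> n)) \<longlonglongrightarrow> 0"
      using M0 by blast
  next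
    fix M :: "nat \<Rightarrow> real"
    assume "\<epsilon> \<in> O(\<lambda>n. real n powr (- 1 / 2)) \<and> \<epsilon> \<in> \<Omega>(\<lambda>n. real n powr (- 1 / 2))"
      and M: "filterlim M at_top sequentially"
    then obtain c where c: "0 < c"
      and ev: "\<forall>\<^sub>F n in sequentially. c * norm (real n powr (- 1 / 2)) \<le> norm (\<epsilon> n)"
      by (auto elim: landau_omega.bigE)
    \<comment> \<open>The lower bound on the rate gives
      \<open>real n * (\<epsilon> n)\<^sup>2 \<ge> c\<^sup>2\<close> eventually, so divergence of
      \<open>M\<close> alone makes the product diverge.\<close>
    have "\<forall>\<^sub>F n in sequentially. c\<^sup>2 * (M n * M n) \<le> (M n)\<^sup>2 * (real n * (\<epsilon> n)\<^sup>2)"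
      using ev eventually_ge_at_top[of 1]
    proof eventually_elim
      case (elim n)
      have "(c * norm (real n powr (- 1 / 2)))\<^sup>2 \<le> (norm (\<epsilon> n))\<^sup>2"
        using elim c by (intro power_mono) auto
      also have "(c * norm (real n powr (- 1 / 2)))\<^sup>2 = c\<^sup>2 / real n"
        using elim by (simp add: power_mult_distrib powr_minus powr_half_sqrt field_simps)
      finally have "c\<^sup>2 \<le> real n * (\<epsilon> n)\<^sup>2" using elim by (simp add: field_simps)
      then have "(M n)\<^sup>2 * c\<^sup>2 \<le> (M n)\<^sup>2 * (real n * (\<epsilon> n)\<^sup>2)" by (intro mult_left_mono) auto
      then show ?case by (simp add: power2_eq_square mult_ac)
    qed
    moreover have "filterlim (\<lambda>n. c\<^sup>2 * (M n * M n)) at_top sequentially"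
      using c by (intro filterlim_tendsto_pos_mult_at_top[OF tendsto_const] filterlim_at_top_mult_at_top M) auto
    ultimately have "filterlim (\<lambda>n. (M n)\<^sup>2 * (real n * (\<epsilon> n)\<^sup>2)) at_top sequentially"
      by (rule filterlim_at_top_mono[rotated])
    moreover have "eventually (\<lambda>n. M0 \<le> M n) sequentially"
      using M by (auto simp: filterlim_at_top)
    ultimately show "(\<lambda>n. expected_posterior_far \<mu> p \<Theta> \<theta>s S \<nu> q n (M n) (\<epsilon> n)) \<longlonglongrightarrow> 0"
      by (intro conv[rule_format])
  qed
qed

end
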